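(* Let $\lambda,\lambda_1$ be real numbers with $\lambda\neq0$, let $n$ be a positive integer, and define $T_{m,\lambda}^{(1)}(n\,|\,\lambda_1)$, $m\ge0$, by \[ {}_1F_{0}\big(-n;\,;\lambda_1 e_{\lambda}(t)\big)=\sum_{m=0}^{\infty}T_{m,\lambda}^{(1)}(n\,|\,\lambda_1)\frac{t^{m}}{m!}, \] where ${}_1F_0(-n;\,;z)=\sum_{k\ge0}\langle -n\rangle_k\frac{z^k}{k!}$. Then for every integer $k\ge0$, \[ T_{n+k,\lambda}^{(1)}(n\,|\,\lambda_{1})=\sum_{j=0}^{n}\binom{n}{j}(-1)^{j}\lambda_{1}^{j}(j)_{n+k,\lambda}=\sum_{j=0}^{n}\sum_{l=0}^{j}\binom{n}{j}(-1)^{j}\lambda_{1}^{j}(j)_{l}\,S_{2,\lambda}(n+k,l). \]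
   Context: $\langle a\rangle_0=1$, $\langle a\rangle_k=a(a+1)\cdots(a+k-1)$. $e_{\lambda}(t)=(1+\lambda t)^{1/\lambda}$; $(x)_{0,\lambda}=1$, $(x)_{m,\lambda}=x(x-\lambda)\cdots(x-(m-1)\lambda)$; $(x)_0=1$, $(x)_l=x(x-1)\cdots(x-l+1)$. The degenerate Stirling numbers of the second kind are defined by $\frac{1}{k!}(e_{\lambda}(t)-1)^{k}=\sum_{n\ge k}S_{2,\lambda}(n,k)\frac{t^{n}}{n!}$ (with $S_{2,\lambda}(n,k)=0$ for $n<k$). *)

theory Defs
  imports Complex_Main "HOL-Computational_Algebra.Formal_Power_Series"
begin

text \<open>All generating functions are formal power series in \<open>t = fps_X\<close>; the binomial series
  \<open>fps_binomial a\<close> is \<open>(1 + t)\<^sup>a\<close>, so \<open>deg_exp \<lambda>\<close> is \<open>(1 + \<lambda>t)\<^bsup>1/\<lambda>\<^esup>\<close> for \<open>\<lambda> \<noteq> 0\<close>.\<close>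

definition deg_exp :: "real \<Rightarrow> real fps" where
  "deg_exp lam = fps_compose (fps_binomial (1 / lam)) (fps_const lam * fps_X)"

definition deg_ffact :: "real \<Rightarrow> real \<Rightarrow> nat \<Rightarrow> real" where
  "deg_ffact lam x m = (\<Prod>i<m. x - real i * lam)"

definition ffact :: "real \<Rightarrow> nat \<Rightarrow> real" where
  "ffact x l = (\<Prod>i<l. x - real i)"

definition deg_stirling2 :: "real \<Rightarrow> nat \<Rightarrow> nat \<Rightarrow> real" where
  "deg_stirling2 lam n k =
     fact n * fps_nth (fps_const (1 / fact k) * (deg_exp lam - 1) ^ k) n"

text \<open>The argument \<open>z\<close> may have a nonzero constant term, for which \<open>fps_compose\<close> is not the
  substitution; the series is therefore summed in the standard (\<open>t\<close>-adic) topology on formal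
  power series.  It has finitely many nonzero terms when \<open>a\<close> is a non-positive integer.\<close>

definition hyp_1F0 :: "real \<Rightarrow> real fps \<Rightarrow> real fps" where
  "hyp_1F0 a z = (\<Sum>k. fps_const (pochhammer a k / fact k) * z ^ k)"

definition T1 :: "real \<Rightarrow> nat \<Rightarrow> nat \<Rightarrow> real \<Rightarrow> real" where
  "T1 lam m n lam1 =
     fact m * fps_nth (hyp_1F0 (- real n) (fps_const lam1 * deg_exp lam)) m"

lemma hyp_1F0_sums:
  "(\<lambda>k. fps_const (pochhammer (- real n) k / fact k) * z ^ k) sums hyp_1F0 (- real n) z"
proof -
  have "summable (\<lambda>k. fps_const (pochhammer (- real n) k / fact k) * z ^ k)"
    by (rule summable_finite[of "{..n}"]) (auto simp: pochhammer_of_nat_eq_0_iff)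
  then show ?thesis
    unfolding hyp_1F0_def by (rule summable_sums)
qed

lemma T1_generating_function:
  "hyp_1F0 (- real n) (fps_const lam1 * deg_exp lam) = Abs_fps (\<lambda>m. T1 lam m n lam1 / fact m)"
  by (simp add: fps_eq_iff T1_def)

lemma deg_stirling2_generating_function:
  "fps_const (1 / fact k) * (deg_exp lam - 1) ^ k = Abs_fps (\<lambda>n. deg_stirling2 lam n k / fact n)"
  by (simp add: fps_eq_iff deg_stirling2_def)

lemma deg_stirling2_eq_0:
  assumes "n < k"
  shows "deg_stirling2 lam n k = 0"
proof -
  have "fps_nth (deg_exp lam - 1) 0 = 0"
    by (simp add: deg_exp_def)
  then have "fps_nth ((deg_exp lam - 1) ^ k) n = 0"
    using assms by (simp add: startsby_zero_power_prefix)
  then show ?thesis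
    by (simp add: deg_stirling2_def)
qed

end

theory Submission imports Defs begin

text \<open>Since \<open>m! [t\<^sup>m] e\<^sub>\<lambda>(t)\<^sup>j = (j)\<^bsub>m,\<lambda>\<^esub>\<close>, the first formula is the coefficientwise reading of
  the terminating series \<open>\<^sub>1F\<^sub>0(-n;;z) = (1 - z)\<^sup>n\<close>.  The second follows by expanding
  \<open>e\<^sub>\<lambda>\<^sup>j = ((e\<^sub>\<lambda> - 1) + 1)\<^sup>j\<close> binomially.\<close>

text \<open>Exponents of binomial series add under powers, so the power is
  \<open>(1 + lam t)\<close> to the exponent \<open>j / lam\<close>. Substituting
  \<open>lam t\<close> gives a factor \<open>lam ^ m\<close>, one \<open>lam\<close> for each of the
  \<open>m\<close> factors of the falling factorial.\<close>

lemma deg_exp_power_nth: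
  assumes "lam \<noteq> 0"
  shows "fact m * fps_nth (deg_exp lam ^ j) m = deg_ffact lam (real j) m"
proof -
  have "deg_exp lam ^ j = fps_compose (fps_binomial (real j / lam)) (fps_const lam * fps_X)"
    by (simp add: deg_exp_def fps_compose_power fps_binomial_power)
  then have "fact m * fps_nth (deg_exp lam ^ j) m = lam ^ m * (\<Prod>i<m. real j / lam - real i)"
    by (simp add: fps_compose_linear gbinomial_prod_rev atLeast0LessThan)
  also have "\<dots> = (\<Prod>i<m. lam * (real j / lam - real i))"
    by (simp add: prod.distrib)
  also have "\<dots> = deg_ffact lam (real j) m"
    unfolding deg_ffact_def using assms by (intro prod.cong) (auto simp: field_simps)
  finally show ?thesis .
qed

lemma pochhammer_minus_over_fact:
  "pochhammer (- real n) k / fact k = (-1) ^ k * real (n choose k)"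
  \<comment> \<open>The sign from \<open>gbinomial_pochhammer\<close> meets the explicit one, and
    \<open>(-1) ^ (2 * k) = 1\<close>.\<close>
  by (simp add: binomial_gbinomial gbinomial_pochhammer flip: power_add mult_2)

lemma hyp_1F0_minus_nat:
  "hyp_1F0 (- real n) z = (\<Sum>k=0..n. fps_const ((-1) ^ k * real (n choose k)) * z ^ k)"
  unfolding hyp_1F0_def pochhammer_minus_over_fact
  \<comment> \<open>The terms with \<open>k > n\<close> vanish because
    \<open>n choose k = 0\<close>.\<close>
  by (rule suminf_finite) (auto simp: not_le)

lemma T1_eq_sum_deg_ffact:
  assumes "lam \<noteq> 0"
  shows "T1 lam m n lam1 =
    (\<Sum>j=0..n. real (n choose j) * (-1) ^ j * lam1 ^ j * deg_ffact lam (real j) m)"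
  by (simp add: T1_def hyp_1F0_minus_nat fps_sum_nth sum_distrib_left power_mult_distrib
      fps_const_power mult_ac flip: deg_exp_power_nth[OF assms])

lemma ffact_nat: "ffact (real j) l = fact l * real (j choose l)"
  by (simp add: ffact_def binomial_gbinomial gbinomial_prod_rev atLeast0LessThan)

lemma deg_ffact_eq_sum_deg_stirling2:
  assumes "lam \<noteq> 0"
  shows "deg_ffact lam (real j) m = (\<Sum>l=0..j. ffact (real j) l * deg_stirling2 lam m l)"
proof -
  have "deg_exp lam ^ j = ((deg_exp lam - 1) + 1) ^ j"
    by simp
  also have "\<dots> = (\<Sum>l=0..j. fps_const (real (j choose l)) * (deg_exp lam - 1) ^ l)"
    by (subst binomial_ring) (simp add: atLeast0AtMost fps_of_nat)
  finally have "deg_ffact lam (real j) m =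
      fact m * (\<Sum>l=0..j. real (j choose l) * fps_nth ((deg_exp lam - 1) ^ l) m)"
    by (simp add: fps_sum_nth flip: deg_exp_power_nth[OF assms])
  then show ?thesis
    \<comment> \<open>The \<open>fact l\<close> in \<open>ffact_nat\<close> cancels the
      \<open>1 / fact l\<close> in \<open>deg_stirling2\<close>, leaving the binomial
      coefficient.\<close>
    by (simp add: ffact_nat deg_stirling2_def sum_distrib_left mult_ac)
qed

theorem theorem3p3:
  fixes lam lam1 :: real and n :: nat
  assumes "lam \<noteq> 0" and "n > 0"
  shows "\<forall>k::nat.
    T1 lam (n + k) n lam1 =
      (\<Sum>j=0..n. real (n choose j) * (-1) ^ j * lam1 ^ j * deg_ffact lam (real j) (n + k)) \<and>
    (\<Sum>j=0..n. real (n choose j) * (-1) ^ j * lam1 ^ j * deg_ffact lam (real j) (n + k)) =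
      (\<Sum>j=0..n. \<Sum>l=0..j. real (n choose j) * (-1) ^ j * lam1 ^ j * ffact (real j) l
         * deg_stirling2 lam (n + k) l)"
  by (simp add: T1_eq_sum_deg_ffact[OF assms(1)] deg_ffact_eq_sum_deg_stirling2[OF assms(1)]
      sum_distrib_left mult.assoc)

end
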